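(* Let $T$ be Plotkin's tie and let $L$ be an FS-domain. Then the Scott function space $[T\to L]$ is a continuous dcpo.
   Context: A dcpo is a poset in which every directed (in particular nonempty) subset has a supremum. A map between dcpos is Scott-continuous if it is monotone and preserves suprema of directed subsets. For dcpos $D,E$, the Scott function space $[D\to E]$ is the dcpo of all Scott-continuous maps $D\to E$ with the pointwise order; directed suprema are computed pointwise. In a dcpo $D$, $a\ll x$ ($a$ is way below $x$) if for every directed $A\subseteq D$ with $x\le\bigvee A$ there is $y\in A$ with $a\le y$. A dcpo $D$ is continuous if for every $x\in D$ the set $\{a\in D: a\ll x\}$ is directed and has supremum $x$. A Scott-continuous map $f:D\to D$ is finitely separated from the identity if there is a finite set $M\subseteq D$ such that for every $x\in D$ there is $m\in M$ with $f(x)\le m\le x$. An FS-domain is a continuous dcpo $D$ for which there is a directed family (pointwise order) $(f_i)_{i\in I}$ of Scott-continuous maps $D\to D$, each finitely separated from the identity, with $x=\bigvee_{i\in I}f_i(x)$ for every $x\in D$. Plotkin's tie is the poset $T=\{\bot,\top\}\cup\{a_n,b_n:n\ge 1\}$ (all listed elements distinct) with $\bot\le x\le\top$ for all $x\in T$ and, for $u,v\in\{a,b\}$, $u_m\le v_n$ if and only if $m<n$ or ($m=n$ and $u_m=v_n$). *)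

theory Defs
  imports "HOL-Library.Lub_Glb" "HOL-Library.FuncSet"
begin

text \<open>
  A poset is a carrier set \<open>D :: 'a::order set\<close> with the order inherited from the type.
  Suprema are taken inside the carrier: \<open>isLub D A x\<close> says that \<open>x \<in> D\<close> is the least
  among the upper bounds of \<open>A\<close> that lie in \<open>D\<close>.
\<close>

definition directed :: "'a::order set \<Rightarrow> bool"
  where "directed A \<longleftrightarrow> A \<noteq> {} \<and> (\<forall>x\<in>A. \<forall>y\<in>A. \<exists>z\<in>A. x \<le> z \<and> y \<le> z)"

definition dcpo :: "'a::order set \<Rightarrow> bool"
  where "dcpo D \<longleftrightarrow> (\<forall>A\<subseteq>D. directed A \<longrightarrow> (\<exists>x. isLub D A x))"

definition scott_continuous :: "'a::order set \<Rightarrow> 'b::order set \<Rightarrow> ('a \<Rightarrow> 'b) \<Rightarrow> bool"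
  where "scott_continuous D E f \<longleftrightarrow>
    f \<in> D \<rightarrow> E \<and> mono_on D f \<and>
    (\<forall>A x. A \<subseteq> D \<and> directed A \<and> isLub D A x \<longrightarrow> isLub E (f ` A) (f x))"

text \<open>
  Elements of the function space are extensional (equal to \<^const>\<open>undefined\<close> off \<open>D\<close>), so
  that each map \<open>D \<rightarrow> E\<close> is represented by exactly one HOL function and the library order on
  functions is the pointwise order on \<open>D\<close>; see \<open>scott_space_le_iff\<close>.
\<close>

definition scott_space :: "'a::order set \<Rightarrow> 'b::order set \<Rightarrow> ('a \<Rightarrow> 'b) set"
  where "scott_space D E = {f \<in> D \<rightarrow>\<^sub>E E. scott_continuous D E f}"

lemma scott_space_le_iff:
  assumes "f \<in> scott_space D E" "g \<in> scott_space D E"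
  shows "f \<le> g \<longleftrightarrow> (\<forall>x\<in>D. f x \<le> g x)"
proof
  assume le: "\<forall>x\<in>D. f x \<le> g x"
  show "f \<le> g"
  proof (rule le_funI)
    fix x
    show "f x \<le> g x"
      using le assms by (cases "x \<in> D") (auto simp: scott_space_def PiE_def extensional_def)
  qed
qed (simp add: le_fun_def)

definition way_below :: "'a::order set \<Rightarrow> 'a \<Rightarrow> 'a \<Rightarrow> bool"
  where "way_below D a x \<longleftrightarrow>
    a \<in> D \<and> x \<in> D \<and>
    (\<forall>A s. A \<subseteq> D \<and> directed A \<and> isLub D A s \<and> x \<le> s \<longrightarrow> (\<exists>y\<in>A. a \<le> y))"

definition continuous_dcpo :: "'a::order set \<Rightarrow> bool"
  where "continuous_dcpo D \<longleftrightarrow>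
    dcpo D \<and> (\<forall>x\<in>D. directed {a \<in> D. way_below D a x} \<and> isLub D {a \<in> D. way_below D a x} x)"

definition finitely_separated :: "'a::order set \<Rightarrow> ('a \<Rightarrow> 'a) \<Rightarrow> bool"
  where "finitely_separated D f \<longleftrightarrow>
    (\<exists>M. finite M \<and> M \<subseteq> D \<and> (\<forall>x\<in>D. \<exists>m\<in>M. f x \<le> m \<and> m \<le> x))"

text \<open>The directed family \<open>(f\<^sub>i)\<close> is given by its set \<open>F\<close> of members.\<close>

definition FS_domain :: "'a::order set \<Rightarrow> bool"
  where "FS_domain D \<longleftrightarrow>
    continuous_dcpo D \<and>
    (\<exists>F. F \<subseteq> scott_space D D \<and> directed F \<and>
         (\<forall>f\<in>F. finitely_separated D f) \<and>
         (\<forall>x\<in>D. isLub D ((\<lambda>f. f x) ` F) x))"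

datatype strand = StrandA | StrandB

text \<open>
  \<open>Knot StrandA n\<close> and \<open>Knot StrandB n\<close> stand for \<open>a\<^sub>n\<close> and \<open>b\<^sub>n\<close>.  The type has knots with
  index \<open>0\<close> as well; these are left out of the carrier \<open>plotkin_tie\<close>.
\<close>

datatype tie = Bot | Top | Knot strand nat

instantiation tie :: order
begin

fun less_eq_tie :: "tie \<Rightarrow> tie \<Rightarrow> bool"
  where
    "Bot \<le> y \<longleftrightarrow> True"
  | "x \<le> Top \<longleftrightarrow> True"
  | "Knot u m \<le> Knot v n \<longleftrightarrow> m < n \<or> (m = n \<and> Knot u m = Knot v n)"
  | "x \<le> (y::tie) \<longleftrightarrow> False"

definition less_tie :: "tie \<Rightarrow> tie \<Rightarrow> bool"
  where "x < y \<longleftrightarrow> x \<le> y \<and> \<not> y \<le> (x::tie)"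

instance
proof
  fix x y z :: tie
  show "x < y \<longleftrightarrow> x \<le> y \<and> \<not> y \<le> x"
    by (rule less_tie_def)
  show "x \<le> x"
    by (cases x) auto
  show "x \<le> z" if "x \<le> y" "y \<le> z"
    using that by (cases x; cases y; cases z) auto
  show "x = y" if "x \<le> y" "y \<le> x"
    using that by (cases x; cases y) auto
qed

end

definition plotkin_tie :: "tie set"
  where "plotkin_tie = {Bot, Top} \<union> {Knot u n | u n. n \<ge> 1}"

end

theory Submission
  imports Defs
begin

text \<open>
  Write \<open>x \<lless> y\<close> for the way-below relation. The finiteness in the definition of an
  FS-domain enters through one consequence: a map \<open>f\<close> finitely separated from the identity
  satisfies \<open>f x \<lless> x\<close> for all \<open>x\<close> (\<open>finitely_separated_way_below\<close>). So \<open>L\<close> has a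
  directed family \<open>F\<close> of Scott-continuous maps below the identity, in the way-below sense and
  at every point, with supremum the identity.

  To approximate a Scott-continuous \<open>h\<close> from the tie to \<open>L\<close>, take \<open>f \<in> F\<close>. The
  composition \<open>f \<circ> f \<circ> h\<close> is pointwise way below \<open>h\<close>, but being way below \<open>h\<close> in the
  function space is a statement about infinitely many points at once. This is repaired by making
  the map constant from some level on. Each of the two strands is a chain with supremum \<open>Top\<close>,
  and \<open>f (h Top) \<lless> h Top\<close>; so there is a level \<open>n\<close> at which \<open>f (h Top)\<close> is below the value
  of \<open>h\<close> on both strands. Then the constant value \<open>c = f (f (h Top))\<close> satisfies
  \<open>c \<lless> f (h Top) \<le> h (Knot u n)\<close> for both strands \<open>u\<close>. Hence the map that is
  \<open>f \<circ> f \<circ> h\<close> below level \<open>n\<close> and \<open>c\<close> from level \<open>n\<close> on is way below \<open>h\<close>, since only the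
  finitely many points up to level \<open>n\<close> have to be tested (\<open>way_below_finitely_determined\<close>).

  These truncated maps form a directed set: as \<open>c \<lless> h (Knot u n)\<close> for both strands, all
  sufficiently large \<open>f' \<in> F\<close> satisfy \<open>c \<le> f' (f' (h (Knot u n)))\<close>, and then a truncation
  built from \<open>f'\<close> at any level dominates the given one. Their supremum is \<open>h\<close>, since a
  truncation built from \<open>f\<close> lies above \<open>f \<circ> f \<circ> h\<close>. A directed set of elements way below
  \<open>h\<close> with supremum \<open>h\<close> is all that continuity at \<open>h\<close> requires.
\<close>

section \<open>Suprema and directed sets\<close>

lemma isLub_iff:
  "isLub D A x \<longleftrightarrow> x \<in> D \<and> (\<forall>a\<in>A. a \<le> x) \<and> (\<forall>u\<in>D. (\<forall>a\<in>A. a \<le> u) \<longrightarrow> x \<le> u)"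
  by (auto simp: isLub_def leastP_def isUb_def setle_def setge_def)

lemma isLub_mem: "isLub D A x \<Longrightarrow> x \<in> D"
  and isLub_upper: "isLub D A x \<Longrightarrow> a \<in> A \<Longrightarrow> a \<le> x"
  and isLub_least: "isLub D A x \<Longrightarrow> u \<in> D \<Longrightarrow> (\<And>a. a \<in> A \<Longrightarrow> a \<le> u) \<Longrightarrow> x \<le> u"
  by (auto simp: isLub_iff)

lemma isLubI:
  assumes "x \<in> D" "\<And>a. a \<in> A \<Longrightarrow> a \<le> x" "\<And>u. u \<in> D \<Longrightarrow> (\<And>a. a \<in> A \<Longrightarrow> a \<le> u) \<Longrightarrow> x \<le> u"
  shows "isLub D A x"
  using assms by (auto simp: isLub_iff)

lemma isLub_eq: "isLub D A x \<Longrightarrow> isLub D A y \<Longrightarrow> x = (y::'a::order)"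
  by (meson isLub_iff order_antisym)

lemma directedD: "directed A \<Longrightarrow> x \<in> A \<Longrightarrow> y \<in> A \<Longrightarrow> \<exists>z\<in>A. x \<le> z \<and> y \<le> z"
  and directed_nonempty: "directed A \<Longrightarrow> A \<noteq> {}"
  by (auto simp: directed_def)

lemma directed_image:
  assumes "directed A" "\<And>x y. x \<in> A \<Longrightarrow> y \<in> A \<Longrightarrow> x \<le> y \<Longrightarrow> g x \<le> g y"
  shows "directed (g ` A)"
  unfolding directed_def
proof (intro conjI ballI)
  fix a b assume "a \<in> g ` A" "b \<in> g ` A"
  then obtain x y where xy: "x \<in> A" "a = g x" "y \<in> A" "b = g y"
    by auto
  then obtain z where "z \<in> A" "x \<le> z" "y \<le> z"
    using directedD[OF assms(1)] by blast
  then show "\<exists>c\<in>g ` A. a \<le> c \<and> b \<le> c"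
    using xy assms(2) by (intro bexI[of _ "g z"]) auto
qed (use directed_nonempty[OF assms(1)] in auto)

text \<open>
  This is how finiteness is exploited throughout: with \<open>P x z\<close> of the form \<open>c x \<le> z x\<close>, finitely
  many pointwise tests are met by one member of \<open>A\<close>; with \<open>P x z\<close> negated, it is a pigeonhole
  principle.
\<close>

lemma directed_eventually_finite:
  assumes dir: "directed A" and "finite S"
    and "\<And>x. x \<in> S \<Longrightarrow> \<exists>y\<in>A. \<forall>z\<in>A. y \<le> z \<longrightarrow> P x z"
  shows "\<exists>y\<in>A. \<forall>z\<in>A. y \<le> z \<longrightarrow> (\<forall>x\<in>S. P x z)"
  using assms(2,3)
proof (induction S)
  case empty
  then show ?case using directed_nonempty[OF dir] by auto
next
  case (insert s S)
  obtain y1 where y1: "y1 \<in> A" "\<forall>z\<in>A. y1 \<le> z \<longrightarrow> (\<forall>x\<in>S. P x z)"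
    using insert by auto
  obtain y2 where y2: "y2 \<in> A" "\<forall>z\<in>A. y2 \<le> z \<longrightarrow> P s z"
    using insert.prems by auto
  obtain y where "y \<in> A" "y1 \<le> y" "y2 \<le> y"
    using directedD[OF dir y1(1) y2(1)] by auto
  then show ?case
    using y1(2) y2(2) by (metis insert_iff order_trans)
qed

section \<open>The way-below relation\<close>

lemma way_belowI:
  assumes "a \<in> D" "x \<in> D"
    "\<And>A s. A \<subseteq> D \<Longrightarrow> directed A \<Longrightarrow> isLub D A s \<Longrightarrow> x \<le> s \<Longrightarrow> \<exists>y\<in>A. a \<le> y"
  shows "way_below D a x"
  using assms by (auto simp: way_below_def)

lemma way_belowD:
  "way_below D a x \<Longrightarrow> A \<subseteq> D \<Longrightarrow> directed A \<Longrightarrow> isLub D A s \<Longrightarrow> x \<le> s \<Longrightarrow> \<exists>y\<in>A. a \<le> y"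
  unfolding way_below_def by blast

lemma way_below_mem: "way_below D a x \<Longrightarrow> a \<in> D" "way_below D a x \<Longrightarrow> x \<in> D"
  by (auto simp: way_below_def)

lemma way_below_imp_le:
  assumes "way_below D a x"
  shows "a \<le> x"
proof -
  have "isLub D {x} x"
    using way_below_mem[OF assms] by (auto simp: isLub_iff)
  then show ?thesis
    using way_belowD[OF assms, of "{x}" x] way_below_mem[OF assms] by (auto simp: directed_def)
qed

lemma way_below_le_trans:
  assumes "way_below D a x" "x \<le> y" "y \<in> D"
  shows "way_below D a y"
proof (rule way_belowI)
  fix A s assume A: "A \<subseteq> D" "directed A" "isLub D A s" and "y \<le> s"
  then show "\<exists>z\<in>A. a \<le> z"
    using way_belowD[OF assms(1) A] order_trans[OF assms(2)] by simp
qed (use way_below_mem[OF assms(1)] assms(3) in auto)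

text \<open>
  The given directed set is cofinal among all elements way below \<open>x\<close>, because \<open>x\<close> is its
  supremum; so it decides directedness and the supremum of that set.
\<close>

lemma continuous_dcpoI:
  assumes "dcpo D"
    and approx: "\<And>x. x \<in> D \<Longrightarrow> \<exists>B. directed B \<and> (\<forall>b\<in>B. way_below D b x) \<and> isLub D B x"
  shows "continuous_dcpo D"
  unfolding continuous_dcpo_def
proof (intro conjI ballI)
  fix x assume x: "x \<in> D"
  let ?W = "{a \<in> D. way_below D a x}"
  obtain B where dir: "directed B" and wb: "\<And>b. b \<in> B \<Longrightarrow> way_below D b x" and lub: "isLub D B x"
    using approx[OF x] by auto
  have BD: "B \<subseteq> D"
    using wb way_below_mem by blast
  have cofinal: "\<exists>b\<in>B. a \<le> b" if "way_below D a x" for a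
    using way_belowD[OF that BD dir lub] by simp
  show "directed ?W"
    unfolding directed_def
  proof (intro conjI ballI)
    show "?W \<noteq> {}"
      using directed_nonempty[OF dir] wb BD by auto
  next
    fix a a' assume "a \<in> ?W" "a' \<in> ?W"
    then obtain b b' where b: "b \<in> B" "a \<le> b" "b' \<in> B" "a' \<le> b'"
      using cofinal[of a] cofinal[of a'] by blast
    then obtain z where z: "z \<in> B" "b \<le> z" "b' \<le> z"
      using directedD[OF dir] by blast
    then show "\<exists>z\<in>?W. a \<le> z \<and> a' \<le> z"
      using b wb BD by (intro bexI[of _ z]) auto
  qed
  show "isLub D ?W x"
  proof (rule isLubI)
    fix u assume "u \<in> D" "\<And>a. a \<in> ?W \<Longrightarrow> a \<le> u"
    then show "x \<le> u"
      using isLub_least[OF lub] wb BD by blast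
  qed (use x way_below_imp_le in auto)
qed fact

section \<open>Scott function spaces\<close>

lemma scott_spaceD:
  assumes "f \<in> scott_space D E"
  shows scott_space_mem: "x \<in> D \<Longrightarrow> f x \<in> E"
    and scott_space_mono: "x \<in> D \<Longrightarrow> y \<in> D \<Longrightarrow> x \<le> y \<Longrightarrow> f x \<le> f y"
    and scott_space_lub: "A \<subseteq> D \<Longrightarrow> directed A \<Longrightarrow> isLub D A s \<Longrightarrow> isLub E (f ` A) (f s)"
  using assms by (auto simp: scott_space_def scott_continuous_def mono_on_def)

lemma scott_spaceI:
  assumes "f \<in> extensional D" "\<And>x. x \<in> D \<Longrightarrow> f x \<in> E"
    "\<And>x y. x \<in> D \<Longrightarrow> y \<in> D \<Longrightarrow> x \<le> y \<Longrightarrow> f x \<le> f y"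
    "\<And>A s. A \<subseteq> D \<Longrightarrow> directed A \<Longrightarrow> isLub D A s \<Longrightarrow> isLub E (f ` A) (f s)"
  shows "f \<in> scott_space D E"
  using assms by (auto simp: scott_space_def scott_continuous_def mono_on_def PiE_def)

lemma directed_pointwise:
  assumes "directed A"
  shows "directed ((\<lambda>f. f x) ` A)"
  using assms by (rule directed_image) (auto simp: le_fun_def)

text \<open>
  The pointwise supremum is Scott-continuous because suprema commute with suprema.
\<close>

lemma scott_space_pointwise_lub:
  assumes "dcpo E" and A: "A \<subseteq> scott_space D E" "directed A"
  shows "\<exists>s. isLub (scott_space D E) A s \<and> (\<forall>x\<in>D. isLub E ((\<lambda>f. f x) ` A) (s x))"
proof -
  have "\<exists>y. isLub E ((\<lambda>f. f x) ` A) y" if "x \<in> D" for x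
  proof -
    have "(\<lambda>f. f x) ` A \<subseteq> E"
      using A(1) scott_space_mem that by blast
    then show ?thesis
      using \<open>dcpo E\<close> directed_pointwise[OF A(2)] unfolding dcpo_def by blast
  qed
  then obtain t where t: "\<And>x. x \<in> D \<Longrightarrow> isLub E ((\<lambda>f. f x) ` A) (t x)"
    by metis
  define s where "s = restrict t D"
  have s: "isLub E ((\<lambda>f. f x) ` A) (s x)" if "x \<in> D" for x
    using t that by (simp add: s_def)
  have upper: "f x \<le> s x" if "f \<in> A" "x \<in> D" for f x
    using isLub_upper[OF s] that by blast
  have least: "s x \<le> u" if "x \<in> D" "u \<in> E" "\<And>f. f \<in> A \<Longrightarrow> f x \<le> u" for x u
    using isLub_least[OF s] that by blast
  have mem: "s x \<in> E" if "x \<in> D" for x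
    using isLub_mem[OF s] that by blast
  have mono: "s x \<le> s y" if "x \<in> D" "y \<in> D" "x \<le> y" for x y
  proof (rule least)
    fix f assume "f \<in> A"
    then show "f x \<le> s y"
      using that A(1) scott_space_mono upper by (meson order_trans subsetD)
  qed (use that mem in auto)
  have ss: "s \<in> scott_space D E"
  proof (rule scott_spaceI)
    show "s \<in> extensional D" by (simp add: s_def)
  next
    fix X x assume X: "X \<subseteq> D" "directed X" "isLub D X x"
    have x: "x \<in> D" using X(3) by (rule isLub_mem)
    show "isLub E (s ` X) (s x)"
    proof (rule isLubI)
      fix u assume u: "u \<in> E" "\<And>a. a \<in> s ` X \<Longrightarrow> a \<le> u"
      show "s x \<le> u"
      proof (rule least[OF x u(1)])
        fix f assume f: "f \<in> A"
        have "isLub E (f ` X) (f x)"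
          using scott_space_lub f A(1) X by blast
        moreover have "f y \<le> u" if "y \<in> X" for y
          using upper[OF f, of y] u(2)[of "s y"] that X(1) by force
        ultimately show "f x \<le> u"
          using isLub_least u(1) by blast
      qed
    next
      fix a assume "a \<in> s ` X"
      then obtain y where "y \<in> X" "a = s y"
        by auto
      then show "a \<le> s x"
        using X(1) mono[of y x] x isLub_upper[OF X(3), of y] by blast
    qed (rule mem[OF x])
  qed (use mem mono in auto)
  have "isLub (scott_space D E) A s"
  proof (rule isLubI)
    fix f assume "f \<in> A"
    then show "f \<le> s"
      using A(1) ss upper scott_space_le_iff by blast
  next
    fix u assume u: "u \<in> scott_space D E" "\<And>a. a \<in> A \<Longrightarrow> a \<le> u"
    show "s \<le> u"
      unfolding scott_space_le_iff[OF ss u(1)]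
      using u least scott_space_mem by (metis le_fun_def)
  qed (rule ss)
  then show ?thesis using s by blast
qed

lemma dcpo_scott_space: "dcpo E \<Longrightarrow> dcpo (scott_space D E)"
  using scott_space_pointwise_lub unfolding dcpo_def[of "scott_space D E"] by blast

lemma scott_space_lub_apply:
  assumes "dcpo E" "A \<subseteq> scott_space D E" "directed A" "isLub (scott_space D E) A s" "x \<in> D"
  shows "isLub E ((\<lambda>f. f x) ` A) (s x)"
  using scott_space_pointwise_lub[OF assms(1-3)] isLub_eq assms(4,5) by blast

text \<open>
  If \<open>g\<close> is determined by its values on a finite set \<open>S\<close>, as the least monotone map with these
  values there, then \<open>g \<le> y\<close> has to be tested on \<open>S\<close> only. Directedness of \<open>A\<close> turns the
  finitely many tests into a single member of \<open>A\<close>.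
\<close>

lemma way_below_finitely_determined:
  assumes "dcpo E" and g: "g \<in> scott_space D E" and h: "h \<in> scott_space D E"
    and S: "finite S" "S \<subseteq> D" and wb: "\<And>x. x \<in> S \<Longrightarrow> way_below E (g x) (h x)"
    and det: "\<And>x. x \<in> D \<Longrightarrow> \<exists>s\<in>S. s \<le> x \<and> g x \<le> g s"
  shows "way_below (scott_space D E) g h"
proof (rule way_belowI[OF g h])
  fix A s assume A: "A \<subseteq> scott_space D E" "directed A" "isLub (scott_space D E) A s" and "h \<le> s"
  have "\<exists>y\<in>A. \<forall>z\<in>A. y \<le> z \<longrightarrow> g x \<le> z x" if x: "x \<in> S" for x
  proof -
    have "x \<in> D" using x S(2) by blast
    have "\<exists>b\<in>(\<lambda>f. f x) ` A. g x \<le> b"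
    proof (rule way_belowD[OF wb[OF x]])
      show "(\<lambda>f. f x) ` A \<subseteq> E"
        using A(1) scott_space_mem \<open>x \<in> D\<close> by blast
      show "directed ((\<lambda>f. f x) ` A)"
        by (rule directed_pointwise[OF A(2)])
      show "isLub E ((\<lambda>f. f x) ` A) (s x)"
        by (rule scott_space_lub_apply[OF \<open>dcpo E\<close> A \<open>x \<in> D\<close>])
      show "h x \<le> s x"
        using \<open>h \<le> s\<close> by (simp add: le_fun_def)
    qed
    then show ?thesis
      by (auto simp: le_fun_def intro: order_trans)
  qed
  then obtain y where y: "y \<in> A" "\<And>x. x \<in> S \<Longrightarrow> g x \<le> y x"
    using directed_eventually_finite[OF A(2) S(1), of "\<lambda>x z. g x \<le> z x"] by blast
  have ys: "y \<in> scott_space D E"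
    using y(1) A(1) by blast
  have "g x \<le> y x" if x: "x \<in> D" for x
  proof -
    obtain r where r: "r \<in> S" "r \<le> x" "g x \<le> g r"
      using det[OF x] by blast
    note r(3)
    also have "g r \<le> y r"
      by (rule y(2)[OF r(1)])
    also have "y r \<le> y x"
      using scott_space_mono[OF ys _ x r(2)] r(1) S(2) by blast
    finally show ?thesis .
  qed
  then show "\<exists>y\<in>A. g \<le> y"
    using y(1) scott_space_le_iff[OF g ys] by blast
qed

section \<open>Approximate identities\<close>

text \<open>
  For \<open>y\<close> in a directed set \<open>A\<close> the separating element \<open>m \<in> M\<close> between \<open>f y\<close> and \<open>y\<close> varies,
  but as \<open>M\<close> is finite some \<open>m\<close> recurs cofinally. This \<open>m\<close> bounds \<open>f\<close> on all of \<open>A\<close>, hence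
  also \<open>f (\<Squnion>A)\<close>, and it lies below a member of \<open>A\<close>.
\<close>

lemma finitely_separated_way_below:
  assumes f: "f \<in> scott_space D D" and "finitely_separated D f" and x: "x \<in> D"
  shows "way_below D (f x) x"
proof (rule way_belowI)
  obtain M where M: "finite M" "M \<subseteq> D" "\<And>x. x \<in> D \<Longrightarrow> \<exists>m\<in>M. f x \<le> m \<and> m \<le> x"
    using assms(2) by (auto simp: finitely_separated_def)
  fix A s assume A: "A \<subseteq> D" "directed A" "isLub D A s" and "x \<le> s"
  have "\<exists>m\<in>M. \<forall>y\<in>A. \<exists>z\<in>A. y \<le> z \<and> f z \<le> m \<and> m \<le> z"
  proof (rule ccontr)
    assume "\<not> ?thesis"
    then have ev: "\<exists>y\<in>A. \<forall>z\<in>A. y \<le> z \<longrightarrow> \<not> (f z \<le> m \<and> m \<le> z)" if "m \<in> M" for m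
      using that by blast
    have "\<exists>y\<in>A. \<forall>z\<in>A. y \<le> z \<longrightarrow> (\<forall>m\<in>M. \<not> (f z \<le> m \<and> m \<le> z))"
      using A(2) M(1) ev by (rule directed_eventually_finite)
    then obtain y where y: "y \<in> A" "\<forall>m\<in>M. \<not> (f y \<le> m \<and> m \<le> y)"
      by blast
    then show False
      using M(3)[of y] A(1) by blast
  qed
  then obtain m where m: "m \<in> M" "\<And>y. y \<in> A \<Longrightarrow> \<exists>z\<in>A. y \<le> z \<and> f z \<le> m \<and> m \<le> z"
    by blast
  have "f y \<le> m" if y: "y \<in> A" for y
  proof -
    obtain z where "z \<in> A" "y \<le> z" "f z \<le> m"
      using m(2)[OF y] by blast
    then show ?thesis
      using scott_space_mono[OF f, of y z] y A(1) by (meson order_trans subsetD)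
  qed
  then have "f s \<le> m"
    using isLub_least[OF scott_space_lub[OF f A]] m(1) M(2) by blast
  moreover have "f x \<le> f s"
    using scott_space_mono[OF f x isLub_mem[OF A(3)] \<open>x \<le> s\<close>] .
  moreover obtain z where z: "z \<in> A" "m \<le> z"
    using directed_nonempty[OF A(2)] m(2) by blast
  ultimately have "f x \<le> z"
    by (meson order_trans)
  then show "\<exists>z\<in>A. f x \<le> z"
    using z(1) by blast
qed (use x scott_space_mem[OF f] in auto)

definition approximate_identity :: "'a::order set \<Rightarrow> ('a \<Rightarrow> 'a) set \<Rightarrow> bool"
  where "approximate_identity D F \<longleftrightarrow>
    F \<subseteq> scott_space D D \<and> directed F \<and>
    (\<forall>f\<in>F. \<forall>x\<in>D. way_below D (f x) x) \<and>
    (\<forall>x\<in>D. isLub D ((\<lambda>f. f x) ` F) x)"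

lemma approximate_identityD:
  assumes "approximate_identity D F"
  shows "f \<in> F \<Longrightarrow> f \<in> scott_space D D" "directed F"
    "f \<in> F \<Longrightarrow> x \<in> D \<Longrightarrow> way_below D (f x) x"
    "x \<in> D \<Longrightarrow> isLub D ((\<lambda>f. f x) ` F) x"
  using assms by (auto simp: approximate_identity_def)

lemma FS_domain_approximate_identity:
  assumes "FS_domain D"
  shows "\<exists>F. approximate_identity D F"
proof -
  obtain F where F: "F \<subseteq> scott_space D D" "directed F" "\<forall>f\<in>F. finitely_separated D f"
    "\<forall>x\<in>D. isLub D ((\<lambda>f. f x) ` F) x"
    using assms by (auto simp: FS_domain_def)
  then have "\<forall>f\<in>F. \<forall>x\<in>D. way_below D (f x) x"
    by (auto intro: finitely_separated_way_below)
  then show ?thesis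
    unfolding approximate_identity_def using F by blast
qed

lemma approximate_identity_twice_mem:
  assumes F: "approximate_identity D F" and "f \<in> F" "x \<in> D"
  shows "f (f x) \<in> D"
  using approximate_identityD(1)[OF F \<open>f \<in> F\<close>] assms scott_space_mem by metis

lemma approximate_identity_twice_mono:
  assumes F: "approximate_identity D F" and "f \<in> F" "g \<in> F" "f \<le> g" "x \<in> D" "y \<in> D" "x \<le> y"
  shows "f (f x) \<le> g (g y)"
proof -
  note f = approximate_identityD(1)[OF F \<open>f \<in> F\<close>] and g = approximate_identityD(1)[OF F \<open>g \<in> F\<close>]
  have "f (f x) \<le> g (f x)"
    using \<open>f \<le> g\<close> by (simp add: le_fun_def)
  also have "g (f x) \<le> g (g x)"
    using \<open>f \<le> g\<close> \<open>x \<in> D\<close> scott_space_mem[OF f] scott_space_mem[OF g] scott_space_mono[OF g]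
    by (simp add: le_fun_def)
  also have "g (g x) \<le> g (g y)"
    using assms scott_space_mem[OF g] scott_space_mono[OF g] by simp
  finally show ?thesis .
qed

text \<open>
  By continuity of \<open>f\<close>, an upper bound of all \<open>f (g x)\<close> with \<open>g \<in> F\<close> is above \<open>f x\<close>; and
  \<open>f (g x)\<close> is dominated by the twofold application of a common upper bound of \<open>f\<close> and \<open>g\<close>.
\<close>

lemma approximate_identity_twice_lub:
  assumes F: "approximate_identity D F" and x: "x \<in> D"
  shows "isLub D ((\<lambda>f. f (f x)) ` F) x"
proof (rule isLubI[OF x])
  note Fs = approximate_identityD(1)[OF F]
  note wb = approximate_identityD(3)[OF F]
  fix a assume "a \<in> (\<lambda>f. f (f x)) ` F"
  then obtain f where f: "f \<in> F" "a = f (f x)"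
    by blast
  have "f (f x) \<le> f x" "f x \<le> x"
    using way_below_imp_le wb scott_space_mem[OF Fs] f(1) x by blast+
  then show "a \<le> x"
    using f(2) by simp
next
  note Fs = approximate_identityD(1)[OF F]
  note dir = approximate_identityD(2)[OF F]
  fix u assume u: "u \<in> D" "\<And>a. a \<in> (\<lambda>f. f (f x)) ` F \<Longrightarrow> a \<le> u"
  have "f x \<le> u" if f: "f \<in> F" for f
  proof -
    have "isLub D (f ` (\<lambda>g. g x) ` F) (f x)"
    proof (rule scott_space_lub[OF Fs[OF f]])
      show "(\<lambda>g. g x) ` F \<subseteq> D"
        using scott_space_mem[OF Fs] x by blast
    qed (use directed_pointwise[OF dir] approximate_identityD(4)[OF F x] in auto)
    moreover have "f (g x) \<le> u" if g: "g \<in> F" for g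
    proof -
      obtain k where k: "k \<in> F" "f \<le> k" "g \<le> k"
        using directedD[OF dir f g] by blast
      have "f (g x) \<le> f (k x)"
        using k x g f scott_space_mem[OF Fs] scott_space_mono[OF Fs] by (simp add: le_fun_def)
      also have "f (k x) \<le> k (k x)"
        using k by (simp add: le_fun_def)
      also have "k (k x) \<le> u"
        using u k by blast
      finally show ?thesis .
    qed
    ultimately show ?thesis
      using isLub_least[OF _ u(1)] by blast
  qed
  then show "x \<le> u"
    using isLub_least[OF approximate_identityD(4)[OF F x] u(1)] by blast
qed

section \<open>The order structure of the tie\<close>

lemma plotkin_tie_simps [simp]:
  "Bot \<in> plotkin_tie" "Top \<in> plotkin_tie" "Knot u n \<in> plotkin_tie \<longleftrightarrow> n \<ge> 1"
  by (auto simp: plotkin_tie_def)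

lemma tie_le_Top [simp]: "x \<le> Top"
  by (cases x) auto

lemma tie_Top_le_iff [simp]: "Top \<le> x \<longleftrightarrow> x = Top"
  by (cases x) auto

lemma finite_strand: "finite (UNIV :: strand set)"
proof -
  have "UNIV = {StrandA, StrandB}"
    using strand.exhaust by auto
  then show ?thesis
    by (metis finite.simps)
qed

lemma directed_strand: "directed {Knot u n |n. n \<ge> 1}"
  unfolding directed_def
proof (intro conjI ballI)
  fix x y assume "x \<in> {Knot u n |n. n \<ge> 1}" "y \<in> {Knot u n |n. n \<ge> 1}"
  then obtain m n where "x = Knot u m" "y = Knot u n" "m \<ge> 1"
    by blast
  then show "\<exists>z\<in>{Knot u n |n. n \<ge> 1}. x \<le> z \<and> y \<le> z"
    by (intro bexI[of _ "Knot u (max m n)"]) auto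
qed auto

lemma isLub_strand: "isLub plotkin_tie {Knot u n |n. n \<ge> 1} Top"
proof (rule isLubI)
  fix x assume "x \<in> plotkin_tie" and ub: "\<And>a. a \<in> {Knot u n |n. n \<ge> 1} \<Longrightarrow> a \<le> x"
  have "Knot u n \<le> x" if "n \<ge> 1" for n
    using ub that by blast
  \<comment> \<open>Level 1 rules out \<open>x = Bot\<close>, and the level after that of \<open>x\<close> rules out knots.\<close>
  note this[of 1] this[of "Suc (case x of Knot v m \<Rightarrow> m)"]
  then show "Top \<le> x"
    by (cases x) auto
qed auto

text \<open>
  Two comparable knots of the same level are equal. So in a directed set of knots of bounded level
  a knot of the highest level is the greatest element; a directed set without greatest element
  therefore climbs through all levels.
\<close>

lemma plotkin_tie_lub_cases:
  assumes A: "A \<subseteq> plotkin_tie" "directed A" "isLub plotkin_tie A x"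
  obtains "x \<in> A" | "x = Top" "\<And>n. \<exists>u m. Knot u m \<in> A \<and> n < m"
proof (cases "x \<in> A")
  case False
  have has_max: "x \<in> A" if "z \<in> A" "\<And>y. y \<in> A \<Longrightarrow> y \<le> z" for z
    using isLub_eq[OF A(3) isLubI[of z plotkin_tie A]] that A(1) by blast
  have "Top \<notin> A"
    using has_max[of Top] False by auto
  have unbounded: "\<exists>u m. Knot u m \<in> A \<and> n < m" for n
  proof (rule ccontr)
    assume *: "\<not> ?thesis"
    let ?P = "\<lambda>m. \<exists>u. Knot u m \<in> A"
    have bound: "m \<le> n" if "?P m" for m
      using * that by (meson not_le)
    show False
    proof (cases "\<exists>m. ?P m")
      case True
      then obtain m0 where m0: "?P m0" by blast
      define m where "m = (GREATEST m. ?P m)"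
      have "?P m"
        unfolding m_def using m0 bound by (rule GreatestI_nat)
      then obtain u where u: "Knot u m \<in> A"
        by blast
      have max: "k \<le> m" if "?P k" for k
        unfolding m_def using that bound by (rule Greatest_le_nat)
      have "y \<le> Knot u m" if "y \<in> A" for y
      proof -
        obtain w where w: "w \<in> A" "y \<le> w" "Knot u m \<le> w"
          using directedD[OF A(2) \<open>y \<in> A\<close> u] by blast
        have "w = Knot u m"
        proof (cases w)
          case (Knot v k)
          then have "k \<le> m"
            using max w(1) by blast
          then show ?thesis
            using w(3) Knot by auto
        qed (use w \<open>Top \<notin> A\<close> in auto)
        then show ?thesis using w by simp
      qed
      then show False
        using has_max[OF u] False by blast
    next
      case none: False
      have "y = Bot" if "y \<in> A" for y
        using that none \<open>Top \<notin> A\<close> by (cases y) auto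
      then show False
        using has_max directed_nonempty[OF A(2)] False by (metis all_not_in_conv order_refl)
    qed
  qed
  have "x = Top"
  proof (cases x)
    case Bot
    obtain u m where "Knot u m \<in> A" using unbounded by blast
    then show ?thesis using isLub_upper[OF A(3)] Bot by force
  next
    case (Knot v n)
    obtain u m where "Knot u m \<in> A" "n < m" using unbounded by blast
    then show ?thesis using isLub_upper[OF A(3)] Knot by force
  qed
  then show ?thesis
    using that(2) unbounded by blast
qed (rule that(1))

text \<open>
  The only suprema in the tie that are not attained are approached along the levels, and there a
  map that is constant from some level on attains its value at \<open>Top\<close>.
\<close>

lemma eventually_constant_scott_space:
  assumes ext: "g \<in> extensional plotkin_tie" and mem: "\<And>x. x \<in> plotkin_tie \<Longrightarrow> g x \<in> E"
    and mono: "\<And>x y. x \<in> plotkin_tie \<Longrightarrow> y \<in> plotkin_tie \<Longrightarrow> x \<le> y \<Longrightarrow> g x \<le> g y"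
    and const: "\<And>u m. n < m \<Longrightarrow> g (Knot u m) = g Top"
  shows "g \<in> scott_space plotkin_tie E"
proof (rule scott_spaceI[OF ext mem mono])
  fix A s assume A: "A \<subseteq> plotkin_tie" "directed A" "isLub plotkin_tie A s"
  have s: "s \<in> plotkin_tie" using A(3) by (rule isLub_mem)
  have attained: "g s \<in> g ` A"
    using A
  proof (cases rule: plotkin_tie_lub_cases)
    case 1
    then show ?thesis by blast
  next
    case 2
    obtain u m where "Knot u m \<in> A" "n < m"
      using 2(2) by blast
    then show ?thesis
      using const[of m u] 2(1) by (metis image_eqI)
  qed
  show "isLub E (g ` A) (g s)"
  proof (rule isLubI)
    fix a assume "a \<in> g ` A"
    then obtain y where "y \<in> A" "a = g y"
      by blast
    then show "a \<le> g s"
      using mono[of y s] A(1) s isLub_upper[OF A(3)] by blast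
  qed (use attained mem s in auto)
qed

section \<open>Truncations\<close>

text \<open>
  The condition \<open>\<exists>u. Knot u n \<le> x\<close> singles out the points from level \<open>n\<close> on. The map \<open>f\<close> is
  applied twice to leave room for an intermediate value: \<open>f (f (h Top)) \<lless> f (h Top)\<close>, and it is
  \<open>f (h Top)\<close> that gets below \<open>h\<close> on level \<open>n\<close>.
\<close>

definition truncation :: "(tie \<Rightarrow> 'a) \<Rightarrow> ('a \<Rightarrow> 'a) \<Rightarrow> nat \<Rightarrow> tie \<Rightarrow> 'a"
  where "truncation h f n =
    (\<lambda>x\<in>plotkin_tie. if \<exists>u. Knot u n \<le> x then f (f (h Top)) else f (f (h x)))"

definition truncations :: "(tie \<Rightarrow> 'a::order) \<Rightarrow> ('a \<Rightarrow> 'a) set \<Rightarrow> (tie \<Rightarrow> 'a) set"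
  where "truncations h F =
    {truncation h f n |f n. f \<in> F \<and> n \<ge> 1 \<and> (\<forall>u. f (h Top) \<le> h (Knot u n))}"

lemma truncation_level_exists:
  assumes F: "approximate_identity L F" and h: "h \<in> scott_space plotkin_tie L" and f: "f \<in> F"
  shows "\<exists>n\<ge>1. \<forall>u. f (h Top) \<le> h (Knot u n)"
proof -
  have Top: "h Top \<in> L"
    using scott_space_mem[OF h] by simp
  have "\<exists>k\<ge>1. f (h Top) \<le> h (Knot u k)" for u
  proof -
    let ?S = "{Knot u n |n. n \<ge> 1}"
    have sub: "?S \<subseteq> plotkin_tie"
      by auto
    have "\<exists>y\<in>h ` ?S. f (h Top) \<le> y"
    proof (rule way_belowD[OF approximate_identityD(3)[OF F f Top]])
      show "isLub L (h ` ?S) (h Top)"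
        by (rule scott_space_lub[OF h sub directed_strand isLub_strand])
      show "h ` ?S \<subseteq> L"
        using sub scott_space_mem[OF h] by blast
      show "directed (h ` ?S)"
        using directed_strand by (rule directed_image) (use sub scott_space_mono[OF h] in blast)
    qed (rule order_refl)
    then show ?thesis by blast
  qed
  then obtain k where k: "\<And>u. k u \<ge> 1" "\<And>u. f (h Top) \<le> h (Knot u (k u))"
    by metis
  define n where "n = max (k StrandA) (k StrandB)"
  have kn: "k u \<le> n" for u
    by (cases u) (auto simp: n_def)
  have "f (h Top) \<le> h (Knot u n)" for u
  proof -
    have "h (Knot u (k u)) \<le> h (Knot u n)"
      using kn[of u] k(1)[of u] by (intro scott_space_mono[OF h]) auto
    then show ?thesis
      by (rule order_trans[OF k(2)])
  qed
  moreover have "n \<ge> 1"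
    using k(1)[of StrandA] kn[of StrandA] by linarith
  ultimately show ?thesis by blast
qed

lemma le_truncation:
  assumes F: "approximate_identity L F" and h: "h \<in> scott_space plotkin_tie L" and "f \<in> F"
    and "x \<in> plotkin_tie"
  shows "f (f (h x)) \<le> truncation h f n x"
proof -
  have "f (f (h x)) \<le> f (f (h Top))"
    by (rule approximate_identity_twice_mono[OF F])
      (use assms scott_space_mem[OF h] scott_space_mono[OF h] in auto)
  then show ?thesis
    using \<open>x \<in> plotkin_tie\<close> by (simp add: truncation_def)
qed

lemma truncation_scott_space:
  assumes F: "approximate_identity L F" and h: "h \<in> scott_space plotkin_tie L" and f: "f \<in> F"
  shows "truncation h f n \<in> scott_space plotkin_tie L"
proof (rule eventually_constant_scott_space[where n = n])
  show "truncation h f n \<in> extensional plotkin_tie"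
    by (simp add: truncation_def)
  show "truncation h f n x \<in> L" if "x \<in> plotkin_tie" for x
    using that scott_space_mem[OF h] approximate_identity_twice_mem[OF F f]
    by (simp add: truncation_def)
  show "truncation h f n x \<le> truncation h f n y"
    if xy: "x \<in> plotkin_tie" "y \<in> plotkin_tie" "x \<le> y" for x y
  proof (cases "\<exists>u. Knot u n \<le> x")
    case True
    then have "\<exists>u. Knot u n \<le> y"
      using order_trans[OF _ xy(3)] by blast
    then show ?thesis
      using True xy by (simp add: truncation_def)
  next
    case False
    then have "truncation h f n x = f (f (h x))"
      using xy by (simp add: truncation_def)
    also have "\<dots> \<le> f (f (h y))"
      by (rule approximate_identity_twice_mono[OF F])
        (use f xy scott_space_mem[OF h] scott_space_mono[OF h] in auto)
    also have "\<dots> \<le> truncation h f n y"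
      by (rule le_truncation[OF F h f xy(2)])
    finally show ?thesis .
  qed
  show "truncation h f n (Knot u m) = truncation h f n Top" if "n < m" for u m
    using that by (auto simp: truncation_def)
qed

text \<open>
  The points to be tested are \<open>Bot\<close> and the knots up to level \<open>n\<close>. On level \<open>n\<close> itself the
  intermediate value \<open>f (h Top)\<close> gives the way-below relation; on lower levels it is inherited
  from \<open>F\<close>.
\<close>

lemma truncation_way_below:
  assumes "dcpo L" and F: "approximate_identity L F" and h: "h \<in> scott_space plotkin_tie L"
    and f: "f \<in> F" and n: "n \<ge> 1" "\<And>u. f (h Top) \<le> h (Knot u n)"
  shows "way_below (scott_space plotkin_tie L) (truncation h f n) h"
proof (rule way_below_finitely_determined[OF \<open>dcpo L\<close> truncation_scott_space[OF F h f] h])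
  note hm = scott_space_mem[OF h] and fm = scott_space_mem[OF approximate_identityD(1)[OF F f]]
  note wb = approximate_identityD(3)[OF F f]
  let ?S = "insert Bot ((\<lambda>(u, m). Knot u m) ` (UNIV \<times> {1..n}))"
  show "finite ?S"
    using finite_strand by auto
  show "?S \<subseteq> plotkin_tie"
    by auto
  have level: "truncation h f n (Knot u n) = f (f (h Top))" for u
    using n(1) by (auto simp: truncation_def)
  show "way_below L (truncation h f n x) (h x)" if "x \<in> ?S" for x
  proof (cases "\<exists>u. Knot u n \<le> x")
    case True
    then obtain v where x: "x = Knot v n"
      using \<open>x \<in> ?S\<close> by auto
    show ?thesis
      unfolding x level by (rule way_below_le_trans[OF wb n(2)]) (use hm fm n(1) in auto)
  next
    case False
    have x: "x \<in> plotkin_tie"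
      using \<open>x \<in> ?S\<close> by auto
    then have "truncation h f n x = f (f (h x))"
      using False by (simp add: truncation_def)
    moreover have "way_below L (f (f (h x))) (h x)"
      by (rule way_below_le_trans[OF wb way_below_imp_le[OF wb]]) (use hm fm x in auto)
    ultimately show ?thesis by simp
  qed
  show "\<exists>s\<in>?S. s \<le> x \<and> truncation h f n x \<le> truncation h f n s" if x: "x \<in> plotkin_tie" for x
  proof (cases "\<exists>u. Knot u n \<le> x")
    case True
    then obtain u where u: "Knot u n \<le> x" by blast
    have "truncation h f n x = truncation h f n (Knot u n)"
      unfolding level using True x by (simp add: truncation_def)
    then show ?thesis
      using u n(1) by (intro bexI[of _ "Knot u n"]) auto
  next
    case False
    then have "x \<in> ?S"
      using x by (cases x) (auto simp: image_iff not_less)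
    then show ?thesis by blast
  qed
qed

text \<open>
  The second truncation may be at any level \<open>k\<close>, even below \<open>n\<close>: its values only grow when it
  becomes constant earlier.
\<close>

lemma truncation_le_truncation:
  assumes F: "approximate_identity L F" and h: "h \<in> scott_space plotkin_tie L"
    and f: "f \<in> F" and g: "g \<in> F" and "f \<le> g" and n: "n \<ge> 1"
    and dom: "\<And>u. f (f (h Top)) \<le> g (g (h (Knot u n)))"
  shows "truncation h f n \<le> truncation h g k"
  unfolding scott_space_le_iff[OF truncation_scott_space[OF F h f] truncation_scott_space[OF F h g]]
proof
  note hm = scott_space_mem[OF h] and hmono = scott_space_mono[OF h]
  fix x assume x: "x \<in> plotkin_tie"
  have "truncation h f n x \<le> g (g (h x))"
  proof (cases "\<exists>u. Knot u n \<le> x")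
    case True
    then obtain u where u: "Knot u n \<le> x" by blast
    have "truncation h f n x = f (f (h Top))"
      using True x by (simp add: truncation_def)
    also have "\<dots> \<le> g (g (h (Knot u n)))"
      by (rule dom)
    also have "\<dots> \<le> g (g (h x))"
      by (rule approximate_identity_twice_mono[OF F]) (use g hm hmono u x n in auto)
    finally show ?thesis .
  next
    case False
    then show ?thesis
      using approximate_identity_twice_mono[OF F f g \<open>f \<le> g\<close>] hm x by (simp add: truncation_def)
  qed
  also have "\<dots> \<le> truncation h g k x"
    by (rule le_truncation[OF F h g x])
  finally show "truncation h f n x \<le> truncation h g k x" .
qed

text \<open>
  At each of the two points of level \<open>n\<close> the value \<open>f (f (h Top))\<close> is way below that of \<open>h\<close>,
  and \<open>h (Knot u n)\<close>
  is the directed supremum of the \<open>g (g (h (Knot u n)))\<close>.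
\<close>

lemma truncation_eventually_dominated:
  assumes F: "approximate_identity L F" and h: "h \<in> scott_space plotkin_tie L"
    and f: "f \<in> F" and n: "n \<ge> 1" "\<And>u. f (h Top) \<le> h (Knot u n)"
  shows "\<exists>f'\<in>F. \<forall>g\<in>F. f' \<le> g \<longrightarrow> (\<forall>k. truncation h f n \<le> truncation h g k)"
proof -
  note hm = scott_space_mem[OF h] and fm = scott_space_mem[OF approximate_identityD(1)[OF F f]]
  note wb = approximate_identityD(3)[OF F f] and dir = approximate_identityD(2)[OF F]
  have ev: "\<exists>y\<in>F. \<forall>g\<in>F. y \<le> g \<longrightarrow> f (f (h Top)) \<le> g (g (h (Knot u n)))" for u
  proof -
    let ?y = "h (Knot u n)"
    have y: "?y \<in> L"
      using hm n by simp
    have wby: "way_below L (f (f (h Top))) ?y"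
      by (rule way_below_le_trans[OF wb n(2)]) (use hm fm y in auto)
    have "\<exists>b\<in>(\<lambda>g. g (g ?y)) ` F. f (f (h Top)) \<le> b"
    proof (rule way_belowD[OF wby _ _ approximate_identity_twice_lub[OF F y] order_refl])
      show "(\<lambda>g. g (g ?y)) ` F \<subseteq> L"
        using approximate_identity_twice_mem[OF F _ y] by blast
      show "directed ((\<lambda>g. g (g ?y)) ` F)"
        using dir by (rule directed_image) (simp add: approximate_identity_twice_mono[OF F] y)
    qed
    then obtain f' where f': "f' \<in> F" "f (f (h Top)) \<le> f' (f' ?y)"
      by blast
    have "f (f (h Top)) \<le> g (g ?y)" if "g \<in> F" "f' \<le> g" for g
      by (rule order_trans[OF f'(2) approximate_identity_twice_mono[OF F f'(1) that y y order_refl]])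
    then show ?thesis
      using f'(1) by blast
  qed
  have "\<exists>y\<in>F. \<forall>g\<in>F. y \<le> g \<longrightarrow> (\<forall>u\<in>UNIV. f (f (h Top)) \<le> g (g (h (Knot u n))))"
    using dir finite_strand ev by (rule directed_eventually_finite)
  then obtain f1 where f1: "f1 \<in> F"
    "\<And>g u. g \<in> F \<Longrightarrow> f1 \<le> g \<Longrightarrow> f (f (h Top)) \<le> g (g (h (Knot u n)))"
    by blast
  obtain f2 where f2: "f2 \<in> F" "f1 \<le> f2" "f \<le> f2"
    using directedD[OF dir f1(1) f] by blast
  have "truncation h f n \<le> truncation h g k" if g: "g \<in> F" "f2 \<le> g" for g k
  proof (rule truncation_le_truncation[OF F h f g(1) _ n(1) f1(2)[OF g(1)]])
    show "f \<le> g" "f1 \<le> g"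
      using order_trans[OF _ g(2)] f2(2,3) by auto
  qed
  then show ?thesis
    using f2(1) by blast
qed

lemma directed_truncations:
  assumes F: "approximate_identity L F" and h: "h \<in> scott_space plotkin_tie L"
  shows "directed (truncations h F)"
  unfolding directed_def
proof (intro conjI ballI)
  obtain f where "f \<in> F"
    using directed_nonempty[OF approximate_identityD(2)[OF F]] by blast
  then show "truncations h F \<noteq> {}"
    using truncation_level_exists[OF F h] unfolding truncations_def by blast
next
  fix a b assume "a \<in> truncations h F" "b \<in> truncations h F"
  then obtain f m g n where
    a: "a = truncation h f m" "f \<in> F" "m \<ge> 1" "\<And>u. f (h Top) \<le> h (Knot u m)" and
    b: "b = truncation h g n" "g \<in> F" "n \<ge> 1" "\<And>u. g (h Top) \<le> h (Knot u n)"
    unfolding truncations_def by blast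
  obtain f' where f': "f' \<in> F" "\<And>p k. p \<in> F \<Longrightarrow> f' \<le> p \<Longrightarrow> a \<le> truncation h p k"
    using truncation_eventually_dominated[OF F h a(2-4)] a(1) by blast
  obtain g' where g': "g' \<in> F" "\<And>p k. p \<in> F \<Longrightarrow> g' \<le> p \<Longrightarrow> b \<le> truncation h p k"
    using truncation_eventually_dominated[OF F h b(2-4)] b(1) by blast
  obtain p where p: "p \<in> F" "f' \<le> p" "g' \<le> p"
    using directedD[OF approximate_identityD(2)[OF F] f'(1) g'(1)] by blast
  obtain k where "k \<ge> 1" "\<And>u. p (h Top) \<le> h (Knot u k)"
    using truncation_level_exists[OF F h p(1)] by blast
  then have "truncation h p k \<in> truncations h F"
    unfolding truncations_def using p(1) by blast
  then show "\<exists>z\<in>truncations h F. a \<le> z \<and> b \<le> z"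
    using f'(2) g'(2) p by blast
qed

lemma truncations_way_below:
  assumes "dcpo L" "approximate_identity L F" "h \<in> scott_space plotkin_tie L"
    and "g \<in> truncations h F"
  shows "way_below (scott_space plotkin_tie L) g h"
  using assms truncation_way_below unfolding truncations_def by blast

lemma isLub_truncations:
  assumes "dcpo L" and F: "approximate_identity L F" and h: "h \<in> scott_space plotkin_tie L"
  shows "isLub (scott_space plotkin_tie L) (truncations h F) h"
proof (rule isLubI[OF h])
  show "g \<le> h" if "g \<in> truncations h F" for g
    using truncations_way_below[OF assms that] by (rule way_below_imp_le)
next
  fix u assume u: "u \<in> scott_space plotkin_tie L" "\<And>g. g \<in> truncations h F \<Longrightarrow> g \<le> u"
  have "h x \<le> u x" if x: "x \<in> plotkin_tie" for x
  proof (rule isLub_least[OF approximate_identity_twice_lub[OF F]])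
    fix a assume "a \<in> (\<lambda>f. f (f (h x))) ` F"
    then obtain f where f: "f \<in> F" "a = f (f (h x))"
      by blast
    obtain n where "n \<ge> 1" "\<And>v. f (h Top) \<le> h (Knot v n)"
      using truncation_level_exists[OF F h f(1)] by blast
    then have "truncation h f n \<in> truncations h F"
      unfolding truncations_def using f(1) by blast
    then have "truncation h f n x \<le> u x"
      using u(2) by (simp add: le_fun_def)
    then show "a \<le> u x"
      using le_truncation[OF F h f(1) x, of n] f(2) by simp
  qed (use x scott_space_mem h u(1) in auto)
  then show "h \<le> u"
    using scott_space_le_iff[OF h u(1)] by blast
qed

theorem theorem6p6:
  fixes L :: "'a::order set"
  assumes "FS_domain L"
  shows "continuous_dcpo (scott_space plotkin_tie L)"
proof -
  have dcpo: "dcpo L"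
    using assms by (simp add: FS_domain_def continuous_dcpo_def)
  obtain F where F: "approximate_identity L F"
    using FS_domain_approximate_identity[OF assms] by blast
  show ?thesis
  proof (rule continuous_dcpoI[OF dcpo_scott_space[OF dcpo]])
    fix h assume h: "h \<in> scott_space plotkin_tie L"
    show "\<exists>B. directed B \<and> (\<forall>b\<in>B. way_below (scott_space plotkin_tie L) b h) \<and>
        isLub (scott_space plotkin_tie L) B h"
      using directed_truncations[OF F h] truncations_way_below[OF dcpo F h]
        isLub_truncations[OF dcpo F h] by blast
  qed
qed

end
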